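(* Let $F$ be a hyperfield with involution $x\mapsto\overline x$, let $\underline M$ be a matroid on a non-empty finite set $E$, let $\mathcal{C}$ be an $F$-signature of $\underline M$ and $\mathcal{D}$ an $F$-signature of the dual matroid $\underline M^*$. Then $\mathcal{C}$ and $\mathcal{D}$ are, respectively, the set of $F$-circuits and the set of $F$-cocircuits of a strong $F$-matroid with underlying matroid $\underline M$ if and only if $X\perp Y$ for all $X\in\mathcal{C}$ and $Y\in\mathcal{D}$.
   Context: Hyperfield $(F,\odot,\boxplus,1,0)$: $\boxplus$ is a commutative associative multivalued addition ($x\boxplus y$ a non-empty subset; $A\boxplus B=\bigcup a\boxplus b$; iterated sums recursive) with $0\boxplus x=\{x\}$, unique $-x$ with $0\in x\boxplus(-x)$, $x\in y\boxplus z\iff z\in x\boxplus(-y)$; $(F,\odot,1)$ commutative monoid with $0\odot x=0$, $a\odot(x\boxplus y)=(a\odot x)\boxplus(a\odot y)$, $0\ne1$, non-zero elements invertible. Involution: $\tau:F\to F$ preserving $\boxplus$, $\tau(0)=0$, multiplicative monoid homomorphism, $\tau^2=\mathrm{id}$; $\overline x=\tau(x)$. $F^E$: functions $E\to F$; support $\underline X=\{e:X(e)\neq0\}$. $X\perp Y$ means $0\in\boxplus_{e\in E}X(e)\odot\overline{Y(e)}$. An $F$-signature of a matroid $N$ on $E$ is a set $\mathcal{C}\subseteq F^E$ with $0\notin\mathcal{C}$, $\alpha\odot X\in\mathcal{C}$ for $X\in\mathcal{C},\alpha\in F\setminus\{0\}$, such that $\{\underline X:X\in\mathcal{C}\}$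 is the set of circuits of $N$ and any two elements of $\mathcal{C}$ with the same support differ by a non-zero scalar. Strong $F$-matroid: a set $\mathcal{C}\subseteq F^E$ ($F$-circuits) satisfying (C0) $0\notin\mathcal{C}$; (C1) closure under non-zero scalars; (C2) $\underline X\subseteq\underline Y$ for $X,Y\in\mathcal{C}$ implies $X=\alpha\odot Y$, $\alpha\ne0$; (C3) if $X_1,\dots,X_k,X\in\mathcal{C}$ ($k\ge1$) form a modular family of size $k+1$ with $\underline X\not\subseteq\bigcup\underline X_i$ and $e_i\in(\underline X\cap\underline X_i)\setminus\bigcup_{j\neq i}\underline X_j$, $X(e_i)=-X_i(e_i)\ne0$, then some $Z\in\mathcal{C}$ has $Z(e_i)=0$ for all $i$ and $Z(f)\in X(f)\boxplus X_1(f)\boxplus\cdots\boxplus X_k(f)$ for all $f$. Here elements with distinct supports form a modular family of size $k$ if the union of their supports has height $k$ in the lattice of all unions of supports of elements of $\mathcal{C}$ ordered by inclusion (height of $U$: largest $n$ with a strict chain $U_0\subsetneq\cdots\subsetneq U_n=U$ in this lattice). The underlying matroid has as circuits the supports of the $F$-circuits. The $F$-cocircuits of the strong $F$-matroid are the elements of minimal non-empty support in $\mathcal{C}^\perp\setminus\{0\}$, where $\mathcal{C}^\perp=\{Y:X\perp Y\ \forall X\in\mathcal{C}\}$. *)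

theory Defs
  imports Main "HOL-Library.FuncSet"
begin

section \<open>Hyperfields\<close>

class hyperfield = comm_monoid_mult + mult_zero + zero_neq_one + uminus +
  fixes hadd :: "'a \<Rightarrow> 'a \<Rightarrow> 'a set"  (infixl \<open>\<boxplus>\<close> 65)
  assumes hadd_nonempty: "x \<boxplus> y \<noteq> {}"
    and hadd_commute: "x \<boxplus> y = y \<boxplus> x"
    and hadd_assoc: "(\<Union>a\<in>x \<boxplus> y. a \<boxplus> z) = (\<Union>b\<in>y \<boxplus> z. x \<boxplus> b)"
    and zero_hadd: "0 \<boxplus> x = {x}"
    and zero_in_hadd_iff: "0 \<in> x \<boxplus> y \<longleftrightarrow> y = - x"
    and hadd_reversible: "x \<in> y \<boxplus> z \<longleftrightarrow> z \<in> x \<boxplus> (- y)"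
    and mult_hadd: "(*) a ` (x \<boxplus> y) = (a * x) \<boxplus> (a * y)"
    and ex_inverse: "x \<noteq> 0 \<Longrightarrow> \<exists>y. x * y = 1"

definition hyperfield_involution :: "('f::hyperfield \<Rightarrow> 'f) \<Rightarrow> bool" where
  "hyperfield_involution \<tau> \<longleftrightarrow>
     (\<forall>x y. \<tau> ` (x \<boxplus> y) = \<tau> x \<boxplus> \<tau> y) \<and>
     \<tau> 0 = 0 \<and> \<tau> 1 = 1 \<and> (\<forall>x y. \<tau> (x * y) = \<tau> x * \<tau> y) \<and>
     (\<forall>x. \<tau> (\<tau> x) = x)"

definition set_hadd :: "'f::hyperfield set \<Rightarrow> 'f set \<Rightarrow> 'f set"  (infixl \<open>\<boxplus>\<^sub>s\<close> 65) where
  "A \<boxplus>\<^sub>s B = (\<Union>a\<in>A. \<Union>b\<in>B. a \<boxplus> b)"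

lemma set_hadd_assoc: "(A \<boxplus>\<^sub>s B) \<boxplus>\<^sub>s C = A \<boxplus>\<^sub>s (B \<boxplus>\<^sub>s C)"
proof -
  have "(A \<boxplus>\<^sub>s B) \<boxplus>\<^sub>s C = (\<Union>a\<in>A. \<Union>b\<in>B. \<Union>c\<in>C. \<Union>d\<in>a \<boxplus> b. d \<boxplus> c)"
    unfolding set_hadd_def by blast
  also have "\<dots> = (\<Union>a\<in>A. \<Union>b\<in>B. \<Union>c\<in>C. \<Union>d\<in>b \<boxplus> c. a \<boxplus> d)"
    by (simp only: hadd_assoc)
  also have "\<dots> = A \<boxplus>\<^sub>s (B \<boxplus>\<^sub>s C)"
    unfolding set_hadd_def by blast
  finally show ?thesis .
qed

lemma set_hadd_commute: "A \<boxplus>\<^sub>s B = B \<boxplus>\<^sub>s A"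
  unfolding set_hadd_def using hadd_commute by blast

lemma set_hadd_zero: "A \<boxplus>\<^sub>s {0} = A"
  by (simp add: set_hadd_def hadd_commute[of _ 0] zero_hadd)

interpretation set_hsum: comm_monoid_set set_hadd "{0::'f::hyperfield}"
  by unfold_locales (rule set_hadd_assoc set_hadd_commute set_hadd_zero)+

text \<open>The iterated hyperaddition of a finite family; the empty sum is \<open>{0}\<close>.\<close>

definition hypersum :: "('i \<Rightarrow> 'f::hyperfield) \<Rightarrow> 'i set \<Rightarrow> 'f set" where
  "hypersum f I = set_hsum.F (\<lambda>i. {f i}) I"

lemma hypersum_empty: "hypersum f {} = {0}"
  by (simp add: hypersum_def)

lemma hypersum_insert:
  "finite I \<Longrightarrow> i \<notin> I \<Longrightarrow> hypersum f (insert i I) = (\<Union>a\<in>hypersum f I. f i \<boxplus> a)"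
  by (simp add: hypersum_def set_hadd_def)


section \<open>Matroids\<close>

locale matroid =
  fixes E :: "'e set" and Ind :: "'e set set"
  assumes finite_ground: "finite E"
    and ind_subset: "I \<in> Ind \<Longrightarrow> I \<subseteq> E"
    and ind_empty: "{} \<in> Ind"
    and ind_mono: "I \<in> Ind \<Longrightarrow> J \<subseteq> I \<Longrightarrow> J \<in> Ind"
    and ind_augment: "I \<in> Ind \<Longrightarrow> J \<in> Ind \<Longrightarrow> card I < card J \<Longrightarrow>
      \<exists>e\<in>J - I. insert e I \<in> Ind"

definition bases :: "'e set set \<Rightarrow> 'e set set" where
  "bases Ind = {B \<in> Ind. \<forall>I\<in>Ind. B \<subseteq> I \<longrightarrow> I = B}"

definition circuits :: "'e set \<Rightarrow> 'e set set \<Rightarrow> 'e set set" where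
  "circuits E Ind = {C. C \<subseteq> E \<and> C \<notin> Ind \<and> (\<forall>D. D \<subset> C \<longrightarrow> D \<in> Ind)}"

text \<open>The independent sets of the dual matroid, whose bases are the complements of bases.\<close>

definition dual_ind :: "'e set \<Rightarrow> 'e set set \<Rightarrow> 'e set set" where
  "dual_ind E Ind = {I. \<exists>B\<in>bases Ind. I \<subseteq> E - B}"


section \<open>Vectors over a hyperfield\<close>

text \<open>Vectors are extensional functions, elements of \<open>E \<rightarrow>\<^sub>E UNIV\<close>.\<close>

definition zero_vec :: "'e set \<Rightarrow> 'e \<Rightarrow> 'f::hyperfield" where
  "zero_vec E = (\<lambda>e\<in>E. 0)"

definition scale_vec :: "'e set \<Rightarrow> 'f::hyperfield \<Rightarrow> ('e \<Rightarrow> 'f) \<Rightarrow> 'e \<Rightarrow> 'f" where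
  "scale_vec E \<alpha> X = (\<lambda>e\<in>E. \<alpha> * X e)"

definition supp :: "'e set \<Rightarrow> ('e \<Rightarrow> 'f::hyperfield) \<Rightarrow> 'e set" where
  "supp E X = {e \<in> E. X e \<noteq> 0}"

definition orthogonal ::
    "('f::hyperfield \<Rightarrow> 'f) \<Rightarrow> 'e set \<Rightarrow> ('e \<Rightarrow> 'f) \<Rightarrow> ('e \<Rightarrow> 'f) \<Rightarrow> bool" where
  "orthogonal \<tau> E X Y \<longleftrightarrow> 0 \<in> hypersum (\<lambda>e. X e * \<tau> (Y e)) E"

definition perp ::
    "('f::hyperfield \<Rightarrow> 'f) \<Rightarrow> 'e set \<Rightarrow> ('e \<Rightarrow> 'f) set \<Rightarrow> ('e \<Rightarrow> 'f) set" where
  "perp \<tau> E \<C> = {Y \<in> E \<rightarrow>\<^sub>E UNIV. \<forall>X\<in>\<C>. orthogonal \<tau> E X Y}"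


section \<open>Signatures and strong matroids over a hyperfield\<close>

definition F_signature :: "'e set \<Rightarrow> 'e set set \<Rightarrow> ('e \<Rightarrow> 'f::hyperfield) set \<Rightarrow> bool" where
  "F_signature E Ind \<C> \<longleftrightarrow>
     \<C> \<subseteq> E \<rightarrow>\<^sub>E UNIV \<and>
     zero_vec E \<notin> \<C> \<and>
     (\<forall>X\<in>\<C>. \<forall>\<alpha>. \<alpha> \<noteq> 0 \<longrightarrow> scale_vec E \<alpha> X \<in> \<C>) \<and>
     supp E ` \<C> = circuits E Ind \<and>
     (\<forall>X\<in>\<C>. \<forall>Y\<in>\<C>. supp E X = supp E Y \<longrightarrow> (\<exists>\<alpha>. \<alpha> \<noteq> 0 \<and> X = scale_vec E \<alpha> Y))"

text \<open>The empty union is included, so this family has least element \<open>{}\<close>.\<close>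

definition support_unions :: "'e set \<Rightarrow> ('e \<Rightarrow> 'f::hyperfield) set \<Rightarrow> 'e set set" where
  "support_unions E \<C> = {\<Union>S | S. S \<subseteq> supp E ` \<C>}"

definition height :: "'a set set \<Rightarrow> 'a set \<Rightarrow> nat" where
  "height L U = Max {n. \<exists>V :: nat \<Rightarrow> 'a set.
     (\<forall>i\<le>n. V i \<in> L) \<and> (\<forall>i<n. V i \<subset> V (Suc i)) \<and> V n = U}"

definition modular_family ::
    "'e set \<Rightarrow> ('e \<Rightarrow> 'f::hyperfield) set \<Rightarrow> nat \<Rightarrow> ('e \<Rightarrow> 'f) set \<Rightarrow> bool" where
  "modular_family E \<C> k S \<longleftrightarrow>
     S \<subseteq> \<C> \<and> finite S \<and> card S = k \<and> inj_on (supp E) S \<and>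
     height (support_unions E \<C>) (\<Union>X\<in>S. supp E X) = k"

definition strong_F_matroid :: "'e set \<Rightarrow> ('e \<Rightarrow> 'f::hyperfield) set \<Rightarrow> bool" where
  "strong_F_matroid E \<C> \<longleftrightarrow>
     \<C> \<subseteq> E \<rightarrow>\<^sub>E UNIV \<and>
     zero_vec E \<notin> \<C> \<and>
     (\<forall>X\<in>\<C>. \<forall>\<alpha>. \<alpha> \<noteq> 0 \<longrightarrow> scale_vec E \<alpha> X \<in> \<C>) \<and>
     (\<forall>X\<in>\<C>. \<forall>Y\<in>\<C>. supp E X \<subseteq> supp E Y \<longrightarrow> (\<exists>\<alpha>. \<alpha> \<noteq> 0 \<and> X = scale_vec E \<alpha> Y)) \<and>
     (\<forall>(k::nat) X Xs e.
        k \<ge> 1 \<longrightarrow>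
        X \<in> \<C> \<longrightarrow> (\<forall>i\<in>{1..k}. Xs i \<in> \<C>) \<longrightarrow>
        modular_family E \<C> (k + 1) (insert X (Xs ` {1..k})) \<longrightarrow>
        \<not> supp E X \<subseteq> (\<Union>i\<in>{1..k}. supp E (Xs i)) \<longrightarrow>
        (\<forall>i\<in>{1..k}.
           e i \<in> (supp E X \<inter> supp E (Xs i)) - (\<Union>j\<in>{1..k} - {i}. supp E (Xs j)) \<and>
           X (e i) = - Xs i (e i) \<and> X (e i) \<noteq> 0) \<longrightarrow>
        (\<exists>Z\<in>\<C>. (\<forall>i\<in>{1..k}. Z (e i) = 0) \<and>
           (\<forall>f\<in>E. Z f \<in> {X f} \<boxplus>\<^sub>s hypersum (\<lambda>i. Xs i f) {1..k})))"

text \<open>A matroid is determined by its ground set and its circuits.\<close>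

definition has_underlying_matroid ::
    "'e set \<Rightarrow> ('e \<Rightarrow> 'f::hyperfield) set \<Rightarrow> 'e set set \<Rightarrow> bool" where
  "has_underlying_matroid E \<C> Ind \<longleftrightarrow> matroid E Ind \<and> circuits E Ind = supp E ` \<C>"

definition F_cocircuits ::
    "('f::hyperfield \<Rightarrow> 'f) \<Rightarrow> 'e set \<Rightarrow> ('e \<Rightarrow> 'f) set \<Rightarrow> ('e \<Rightarrow> 'f) set" where
  "F_cocircuits \<tau> E \<C> =
     {Y \<in> perp \<tau> E \<C> - {zero_vec E}.
        \<not> (\<exists>Z\<in>perp \<tau> E \<C> - {zero_vec E}. supp E Z \<subset> supp E Y)}"

end

theory Submission
  imports Defs
begin

text \<open>The forward implication is immediate, since cocircuits lie in the orthogonal space.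
  Conversely, let \<open>\<C> \<perp> \<D>\<close>. Cocircuits are recovered because a non-empty set meeting no circuit
  in exactly one element contains a cocircuit, and any two elements \<open>e, f\<close> of a cocircuit are its
  intersection with some circuit, which fixes the ratio of the values at \<open>e\<close> and \<open>f\<close>.
  For modular elimination of \<open>e\<^sub>1, \<dots>, e\<^sub>k\<close> choose \<open>e\<^sub>0\<close> in the support of \<open>X\<close> but in no support of an
  \<open>X\<^sub>i\<close>, and let \<open>U\<close> be the union of all these supports. Modularity says exactly that
  \<open>I = U - {e\<^sub>0, \<dots>, e\<^sub>k}\<close> is independent: a circuit in \<open>I\<close> would start a chain of length \<open>k + 2\<close>
  below \<open>U\<close>. Then \<open>I \<union> {e\<^sub>0}\<close> contains a circuit, the support of \<open>Z\<close> scaled to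
  \<open>Z(e\<^sub>0) = X(e\<^sub>0)\<close>. For \<open>f \<in> I\<close> a cocircuit \<open>Y\<close> meeting \<open>I\<close> in \<open>f\<close> only turns the
  relations \<open>X \<perp> Y\<close>, \<open>X\<^sub>i \<perp> Y\<close>, \<open>Z \<perp> Y\<close> into the required membership for \<open>Z(f)\<close>.\<close>

section \<open>Hyperfields\<close>

text \<open>Multiplying \<open>0 \<in> x \<boxplus> (- x)\<close> by \<open>c\<close> and using
  distributivity exhibits \<open>c * (- x)\<close> as a negative of \<open>c * x\<close>; negatives
  are unique.\<close>

lemma mult_minus_right_hyperfield: "c * (- x) = - (c * x)" for c x :: "'f::hyperfield"
proof -
  have "0 \<in> x \<boxplus> (- x)" by (simp add: zero_in_hadd_iff)
  then have "c * 0 \<in> (*) c ` (x \<boxplus> (- x))" by (rule imageI)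
  then have "0 \<in> c * x \<boxplus> c * (- x)" by (simp only: mult_hadd mult_zero_right)
  then show ?thesis by (simp only: zero_in_hadd_iff)
qed

lemma mult_minus_left_hyperfield: "(- x) * c = - (x * c)" for c x :: "'f::hyperfield"
  using mult_minus_right_hyperfield[of c x] by (simp add: mult.commute)

lemma minus_minus_hyperfield: "- (- x) = x" for x :: "'f::hyperfield"
  by (metis hadd_commute zero_in_hadd_iff)

lemma mult_left_cancel_hyperfield:
  fixes c :: "'f::hyperfield"
  assumes "c \<noteq> 0" "c * x = c * y"
  shows "x = y"
  using assms by (metis ex_inverse mult.assoc mult.commute mult_1)

lemma mult_eq_0_hyperfield: "c * x = 0 \<longleftrightarrow> c = 0 \<or> x = 0" for c x :: "'f::hyperfield"
  by (metis mult_left_cancel_hyperfield mult_zero_left mult_zero_right)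

lemma ex_scalar_hyperfield:
  fixes x :: "'f::hyperfield"
  assumes "x \<noteq> 0" "y \<noteq> 0"
  obtains \<alpha> where "\<alpha> \<noteq> 0" "\<alpha> * x = y"
proof -
  obtain z where "x * z = 1" using ex_inverse[OF assms(1)] by blast
  then have "(y * z) * x = y" by (metis mult.assoc mult.commute mult_1)
  then show thesis using that assms(2) by (metis mult_zero_left)
qed

text \<open>Uniqueness of negatives. This equivalence later turns an orthogonality relation into the
  membership demanded by elimination.\<close>

lemma zero_in_minus_set_hadd_iff: "0 \<in> {- z} \<boxplus>\<^sub>s A \<longleftrightarrow> z \<in> A" for z :: "'f::hyperfield"
  by (auto simp: set_hadd_def zero_in_hadd_iff minus_minus_hyperfield)

lemma set_hadd_scale: "(*) c ` (A \<boxplus>\<^sub>s B) = ((*) c ` A) \<boxplus>\<^sub>s ((*) c ` B)"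
  by (simp add: set_hadd_def image_UN mult_hadd)

section \<open>Hypersums over finite families\<close>

lemma hypersum_singleton: "hypersum f {i} = {f i}"
  by (simp add: hypersum_def)

lemma hypersum_insert_set_hadd:
  "finite I \<Longrightarrow> i \<notin> I \<Longrightarrow> hypersum f (insert i I) = {f i} \<boxplus>\<^sub>s hypersum f I"
  by (simp add: hypersum_def)

lemma hypersum_cong: "(\<And>i. i \<in> I \<Longrightarrow> f i = g i) \<Longrightarrow> hypersum f I = hypersum g I"
  unfolding hypersum_def by (rule set_hsum.cong) auto

lemma hypersum_scale:
  assumes "finite I"
  shows "hypersum (\<lambda>i. c * f i) I = (*) c ` hypersum f I"
  using assms
  by induction (simp_all add: hypersum_empty hypersum_insert_set_hadd set_hadd_scale)

lemma hypersum_reindex: "inj_on h I \<Longrightarrow> hypersum f (h ` I) = hypersum (\<lambda>i. f (h i)) I"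
  by (simp add: hypersum_def set_hsum.reindex comp_def)

lemma hypersum_mono_neutral:
  assumes "finite I" "J \<subseteq> I" "\<And>i. i \<in> I - J \<Longrightarrow> f i = 0"
  shows "hypersum f I = hypersum f J"
  unfolding hypersum_def by (rule set_hsum.mono_neutral_right) (use assms in auto)

lemma hypersum_zero: "(\<And>i. i \<in> I \<Longrightarrow> f i = 0) \<Longrightarrow> hypersum f I = {0}"
  unfolding hypersum_def by (rule set_hsum.neutral) auto

lemma hypersum_single_nonzero:
  assumes "finite I" "a \<in> I" "\<And>i. i \<in> I \<Longrightarrow> i \<noteq> a \<Longrightarrow> f i = 0"
  shows "hypersum f I = {f a}"
  using hypersum_mono_neutral[of I "{a}" f] assms by (auto simp: hypersum_singleton)

section \<open>The involution\<close>

lemma involution_eq_0_iff: "hyperfield_involution \<tau> \<Longrightarrow> \<tau> x = 0 \<longleftrightarrow> x = 0"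
  unfolding hyperfield_involution_def by metis

lemma involution_mult: "hyperfield_involution \<tau> \<Longrightarrow> \<tau> (x * y) = \<tau> x * \<tau> y"
  unfolding hyperfield_involution_def by metis

lemma involution_inject: "hyperfield_involution \<tau> \<Longrightarrow> \<tau> x = \<tau> y \<longleftrightarrow> x = y"
  unfolding hyperfield_involution_def by metis

section \<open>Orthogonal vectors\<close>

lemma orthogonal_supp_inter:
  assumes "finite E" and \<tau>: "hyperfield_involution \<tau>"
    and "orthogonal \<tau> E X Y"
    and "supp E X \<inter> supp E Y \<subseteq> S" "S \<subseteq> E"
  shows "0 \<in> hypersum (\<lambda>g. X g * \<tau> (Y g)) S"
proof -
  have "X g * \<tau> (Y g) = 0" if "g \<in> E - S" for g
    using that assms(4) by (auto simp: supp_def mult_eq_0_hyperfield involution_eq_0_iff[OF \<tau>])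
  with hypersum_mono_neutral[of E S "\<lambda>g. X g * \<tau> (Y g)"] assms(1,3,5) show ?thesis
    by (simp add: orthogonal_def)
qed

text \<open>The sum would reduce to one product of non-zero factors, which is non-zero in a
  hyperfield.\<close>

lemma orthogonal_supp_inter_not_singleton:
  assumes "finite E" and \<tau>: "hyperfield_involution \<tau>" and "orthogonal \<tau> E X Y"
  shows "supp E X \<inter> supp E Y \<noteq> {e}"
proof
  assume eq: "supp E X \<inter> supp E Y = {e}"
  then have e: "e \<in> E" "X e \<noteq> 0" "Y e \<noteq> 0" by (auto simp: supp_def)
  with orthogonal_supp_inter[OF assms, of "{e}"] eq have "X e * \<tau> (Y e) = 0"
    by (simp add: hypersum_singleton)
  with e show False by (simp add: mult_eq_0_hyperfield involution_eq_0_iff[OF \<tau>])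
qed

text \<open>With only two terms left, uniqueness of negatives makes the multivalued relation an
  equation. Only an inclusion is assumed, so either term may be zero.\<close>

lemma orthogonal_supp_inter_pair:
  assumes "finite E" and \<tau>: "hyperfield_involution \<tau>" and "orthogonal \<tau> E X Y"
    and "supp E X \<inter> supp E Y \<subseteq> {a, b}" "a \<noteq> b" "a \<in> E" "b \<in> E"
  shows "X b * \<tau> (Y b) = - (X a * \<tau> (Y a))"
proof -
  have "0 \<in> hypersum (\<lambda>g. X g * \<tau> (Y g)) {b, a}"
    by (rule orthogonal_supp_inter[OF assms(1-3)]) (use assms in auto)
  then have "0 \<in> X a * \<tau> (Y a) \<boxplus> X b * \<tau> (Y b)"
    using assms(5) by (simp add: hypersum_insert_set_hadd hypersum_singleton set_hadd_def hadd_commute)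
  then show ?thesis by (simp only: zero_in_hadd_iff)
qed

lemma supp_scale_vec: "\<alpha> \<noteq> 0 \<Longrightarrow> supp E (scale_vec E \<alpha> X) = supp E X"
  by (auto simp: supp_def scale_vec_def mult_eq_0_hyperfield)

text \<open>Extensional functions agree outside \<open>E\<close>, so a vector with empty support is
  \<open>zero_vec E\<close> itself.\<close>

lemma supp_nonempty: "X \<in> E \<rightarrow>\<^sub>E UNIV \<Longrightarrow> X \<noteq> zero_vec E \<Longrightarrow> supp E X \<noteq> {}"
  by (auto simp: supp_def zero_vec_def PiE_def fun_eq_iff extensional_def split: if_splits)

section \<open>Circuits and cocircuits of a matroid\<close>

lemma circuits_antichain: "C \<in> circuits E Ind \<Longrightarrow> D \<in> circuits E Ind \<Longrightarrow> C \<subseteq> D \<Longrightarrow> C = D"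
  unfolding circuits_def by blast

lemma dependent_contains_circuit:
  assumes "finite E" "S \<subseteq> E" "S \<notin> Ind"
  obtains C where "C \<in> circuits E Ind" "C \<subseteq> S"
proof -
  have "finite {T. T \<subseteq> S \<and> T \<notin> Ind}"
    by (rule finite_subset[of _ "Pow S"]) (use assms finite_subset in auto)
  from finite_has_minimal2[OF this, of S] assms obtain C where
    C: "C \<subseteq> S" "C \<notin> Ind" "\<forall>T. T \<subseteq> S \<and> T \<notin> Ind \<longrightarrow> T \<subseteq> C \<longrightarrow> C = T" by auto
  then have "C \<in> circuits E Ind" using assms unfolding circuits_def by blast
  with C that show thesis by blast
qed

context matroid
begin

lemma independent_subset_basis:
  assumes "I \<in> Ind"
  obtains B where "B \<in> bases Ind" "I \<subseteq> B"
proof -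
  have "finite Ind"
    by (rule finite_subset[of _ "Pow E"]) (use finite_ground ind_subset in auto)
  from finite_has_maximal2[OF this assms] obtain B where
    "B \<in> Ind" "I \<subseteq> B" "\<forall>J\<in>Ind. B \<subseteq> J \<longrightarrow> B = J" by auto
  then have "B \<in> bases Ind" unfolding bases_def by blast
  then show thesis using \<open>I \<subseteq> B\<close> by (rule that)
qed

text \<open>Maximality of \<open>B\<close> makes \<open>insert e B\<close> dependent; a circuit in
  it does not fit into \<open>B\<close>, so it contains \<open>e\<close>.\<close>

lemma fundamental_circuit:
  assumes "B \<in> bases Ind" "e \<in> E - B"
  obtains C where "C \<in> circuits E Ind" "e \<in> C" "C \<subseteq> insert e B"
proof -
  have "B \<in> Ind" and max: "\<And>J. J \<in> Ind \<Longrightarrow> B \<subseteq> J \<Longrightarrow> J = B"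
    using assms(1) by (auto simp: bases_def)
  have "insert e B \<notin> Ind" using max[of "insert e B"] assms(2) by auto
  moreover have "insert e B \<subseteq> E" using ind_subset[OF \<open>B \<in> Ind\<close>] assms(2) by simp
  ultimately obtain C where C: "C \<in> circuits E Ind" "C \<subseteq> insert e B"
    using dependent_contains_circuit[OF finite_ground] by metis
  have "C \<notin> Ind" using C(1) by (simp add: circuits_def)
  then have "\<not> C \<subseteq> B" using \<open>B \<in> Ind\<close> ind_mono by blast
  with C(2) have "e \<in> C" by blast
  with C show thesis by (intro that)
qed

text \<open>Extend \<open>I\<close> to a basis \<open>B\<close> and take the fundamental cocircuit
  of \<open>f\<close>: it contains \<open>f\<close>, and its other elements lie in
  \<open>E - B\<close>, hence outside \<open>I\<close>.\<close>

lemma ex_cocircuit_inter_independent: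
  assumes "I \<in> Ind" "f \<in> I"
  obtains D where "D \<in> circuits E (dual_ind E Ind)" "D \<inter> I = {f}"
proof -
  obtain B where B: "B \<in> bases Ind" "I \<subseteq> B" using independent_subset_basis[OF assms(1)] .
  then have "B \<subseteq> E" using ind_subset unfolding bases_def by blast
  have "f \<in> B" using B(2) assms(2) by blast
  have "insert f (E - B) \<notin> dual_ind E Ind"
  proof
    assume "insert f (E - B) \<in> dual_ind E Ind"
    then obtain B' where B': "B' \<in> bases Ind" "insert f (E - B) \<subseteq> E - B'"
      unfolding dual_ind_def by blast
    moreover have "B' \<subseteq> E" "B \<in> Ind"
      using B(1) B'(1) ind_subset unfolding bases_def by auto
    ultimately have "B' \<subseteq> B" "f \<notin> B'" by blast+
    with B'(1) \<open>B \<in> Ind\<close> \<open>f \<in> B\<close> show False unfolding bases_def by blast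
  qed
  moreover have "insert f (E - B) \<subseteq> E" using \<open>B \<subseteq> E\<close> \<open>f \<in> B\<close> by blast
  ultimately obtain D where
    D: "D \<in> circuits E (dual_ind E Ind)" "D \<subseteq> insert f (E - B)"
    using dependent_contains_circuit[OF finite_ground] by metis
  have "D \<notin> dual_ind E Ind" using D(1) by (simp add: circuits_def)
  then have "\<not> D \<subseteq> E - B" using B(1) unfolding dual_ind_def by blast
  with D(2) B(2) assms(2) have "D \<inter> I = {f}" by blast
  with D(1) that show thesis by blast
qed

text \<open>If \<open>S\<close> were independent in the dual, it would avoid a basis, and the
  fundamental circuit of any \<open>e \<in> S\<close> would meet \<open>S\<close> in
  \<open>e\<close> alone.\<close>

lemma contains_cocircuit:
  assumes "S \<subseteq> E" "S \<noteq> {}" "\<And>C e. C \<in> circuits E Ind \<Longrightarrow> C \<inter> S \<noteq> {e}"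
  obtains D where "D \<in> circuits E (dual_ind E Ind)" "D \<subseteq> S"
proof -
  have "S \<notin> dual_ind E Ind"
  proof
    assume "S \<in> dual_ind E Ind"
    then obtain B where B: "B \<in> bases Ind" "S \<subseteq> E - B" unfolding dual_ind_def by blast
    obtain e where e: "e \<in> S" using assms(2) by blast
    then obtain C where "C \<in> circuits E Ind" "e \<in> C" "C \<subseteq> insert e B"
      using fundamental_circuit[OF B(1)] B(2) by blast
    with B(2) e assms(3)[of C e] show False by blast
  qed
  with dependent_contains_circuit[OF finite_ground assms(1)] that show thesis by blast
qed

text \<open>By minimality of \<open>D\<close> some basis avoids \<open>D - {e}\<close>; the
  fundamental circuit of \<open>f\<close> for that basis can meet \<open>D\<close> only in
  \<open>f\<close> and \<open>e\<close>.\<close>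

lemma ex_circuit_inter_cocircuit_subset_pair:
  assumes "D \<in> circuits E (dual_ind E Ind)" "e \<in> D" "f \<in> D" "e \<noteq> f"
  obtains C where "C \<in> circuits E Ind" "f \<in> C" "C \<inter> D \<subseteq> {e, f}"
proof -
  have "D - {e} \<in> dual_ind E Ind" "D \<subseteq> E" using assms(1,2) unfolding circuits_def by blast+
  then obtain B where B: "B \<in> bases Ind" "D - {e} \<subseteq> E - B" unfolding dual_ind_def by blast
  then obtain C where "C \<in> circuits E Ind" "f \<in> C" "C \<subseteq> insert f B"
    using fundamental_circuit[OF B(1), of f] assms by blast
  with B(2) that show thesis by blast
qed

end

text \<open>\<open>height\<close> is a \<open>Max\<close>, so the set of chain lengths must be shown
  finite: strict chains gain an element at each step, which bounds their length by
  \<open>card (V n)\<close>.\<close>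

lemma chain_length_le_height:
  assumes fin: "finite (V n)" and "\<And>i. i \<le> n \<Longrightarrow> V i \<in> L" "\<And>i. i < n \<Longrightarrow> V i \<subset> V (Suc i)"
  shows "n \<le> height L (V n)"
proof -
  define lengths where "lengths = {m. \<exists>W :: nat \<Rightarrow> 'a set.
     (\<forall>i\<le>m. W i \<in> L) \<and> (\<forall>i<m. W i \<subset> W (Suc i)) \<and> W m = V n}"
  have "m \<le> card (V n)" if "m \<in> lengths" for m
  proof -
    from that obtain W where W: "\<forall>i<m. W i \<subset> W (Suc i)" "W m = V n"
      unfolding lengths_def by blast
    have sub: "W i \<subseteq> V n" if "i \<le> m" for i
      using that
    proof (induction rule: inc_induct)
      case base
      show ?case using W(2) by simp
    next
      case (step i)
      then show ?case using W(1) by blast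
    qed
    have "i \<le> card (W i)" if "i \<le> m" for i
      using that
    proof (induction i)
      case (Suc i)
      have "finite (W (Suc i))" using sub[OF Suc.prems] fin finite_subset by blast
      with W(1) Suc.prems have "card (W i) < card (W (Suc i))"
        by (simp add: psubset_card_mono)
      with Suc show ?case by simp
    qed simp
    from this[of m] W(2) show ?thesis by simp
  qed
  then have "finite lengths" by (meson finite_nat_set_iff_bounded_le)
  moreover have "n \<in> lengths" using assms(2,3) unfolding lengths_def by blast
  ultimately show ?thesis unfolding height_def lengths_def[symmetric] by (rule Max_ge)
qed

section \<open>Orthogonal signatures\<close>

locale orthogonal_signatures = matroid E Ind
  for E :: "'e set" and Ind +
  fixes \<tau> :: "'f::hyperfield \<Rightarrow> 'f" and \<C> \<D> :: "('e \<Rightarrow> 'f) set"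
  assumes \<tau>: "hyperfield_involution \<tau>"
    and circuit_signature: "F_signature E Ind \<C>"
    and cocircuit_signature: "F_signature E (dual_ind E Ind) \<D>"
    and orth: "X \<in> \<C> \<Longrightarrow> Y \<in> \<D> \<Longrightarrow> orthogonal \<tau> E X Y"
begin

section \<open>Recovering the cocircuits from the orthogonal space\<close>

lemma supp_circuits: "supp E ` \<C> = circuits E Ind"
  using circuit_signature by (simp add: F_signature_def)

lemma supp_cocircuits: "supp E ` \<D> = circuits E (dual_ind E Ind)"
  using cocircuit_signature by (simp add: F_signature_def)

lemma cocircuit_signature_subset_perp: "\<D> \<subseteq> perp \<tau> E \<C> - {zero_vec E}"
  using cocircuit_signature orth by (auto simp: F_signature_def perp_def)

lemma perp_contains_cocircuit:
  assumes "Y \<in> perp \<tau> E \<C> - {zero_vec E}"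
  obtains Y' where "Y' \<in> \<D>" "supp E Y' \<subseteq> supp E Y"
proof -
  have "supp E Y \<noteq> {}" using assms by (simp add: perp_def supp_nonempty)
  moreover have "C \<inter> supp E Y \<noteq> {e}" if C: "C \<in> circuits E Ind" for C e
  proof -
    obtain X where "X \<in> \<C>" "C = supp E X" using C supp_circuits by blast
    then show ?thesis
      using assms orthogonal_supp_inter_not_singleton[OF finite_ground \<tau>]
      by (simp add: perp_def)
  qed
  moreover have "supp E Y \<subseteq> E" by (auto simp: supp_def)
  ultimately obtain D where "D \<in> circuits E (dual_ind E Ind)" "D \<subseteq> supp E Y"
    using contains_cocircuit by metis
  with that supp_cocircuits show thesis by (metis imageE)
qed

text \<open>The scalar is read off at one \<open>e\<close> of the support. At any other
  \<open>f\<close> of the support, a circuit meeting it within \<open>{e, f}\<close> determines the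
  value at \<open>f\<close> from that at \<open>e\<close>, in the same way for \<open>Y\<close> and
  \<open>Y'\<close>.\<close>

lemma perp_eq_scale_vec:
  assumes Y: "Y \<in> perp \<tau> E \<C>" and Y': "Y' \<in> \<D>" and supp_eq: "supp E Y' = supp E Y"
  obtains \<alpha> where "\<alpha> \<noteq> 0" "Y = scale_vec E \<alpha> Y'"
proof -
  have D: "supp E Y \<in> circuits E (dual_ind E Ind)" using Y' supp_eq supp_cocircuits by blast
  have "supp E Y' \<noteq> {}"
    using Y' cocircuit_signature_subset_perp by (intro supp_nonempty) (auto simp: perp_def)
  then obtain e where e: "e \<in> supp E Y" using supp_eq by blast
  then have "e \<in> E" "Y' e \<noteq> 0" "Y e \<noteq> 0" using supp_eq by (auto simp: supp_def)
  then obtain \<alpha> where \<alpha>: "\<alpha> \<noteq> 0" "\<alpha> * Y' e = Y e" using ex_scalar_hyperfield by metis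
  have "Y f = \<alpha> * Y' f" if f: "f \<in> E" for f
  proof (cases "f = e \<or> f \<notin> supp E Y")
    case True
    have "Y' f = 0 \<and> Y f = 0" if "f \<notin> supp E Y" using that f supp_eq by (auto simp: supp_def)
    then show ?thesis using True \<alpha>(2) by auto
  next
    case False
    then obtain C where C: "C \<in> circuits E Ind" "f \<in> C" "C \<inter> supp E Y \<subseteq> {e, f}"
      using ex_circuit_inter_cocircuit_subset_pair[OF D e] by metis
    then obtain X where X: "X \<in> \<C>" "C = supp E X" using supp_circuits by blast
    with C(2) have "X f \<noteq> 0" by (simp add: supp_def)
    \<comment> \<open>Stated for a general \<open>W\<close> because it is applied to both
      \<open>Y\<close> and \<open>Y'\<close>.\<close>
    have ratio: "X f * \<tau> (W f) = - (X e * \<tau> (W e))"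
      if "orthogonal \<tau> E X W" "supp E W = supp E Y" for W
      by (rule orthogonal_supp_inter_pair[OF finite_ground \<tau> that(1)])
        (use C(3) X False \<open>e \<in> E\<close> f that(2) in auto)
    have "X f * \<tau> (Y f) = - (X e * \<tau> (Y e))"
      using ratio Y X(1) by (simp add: perp_def)
    also have "\<dots> = \<tau> \<alpha> * (- (X e * \<tau> (Y' e)))"
      using \<alpha>(2)[symmetric]
      by (simp add: involution_mult[OF \<tau>] mult_minus_right_hyperfield mult.left_commute)
    also have "\<dots> = \<tau> \<alpha> * (X f * \<tau> (Y' f))"
      using ratio[OF orth[OF X(1) Y'] supp_eq] by simp
    also have "\<dots> = X f * \<tau> (\<alpha> * Y' f)"
      by (simp add: involution_mult[OF \<tau>] mult.left_commute)
    finally show ?thesis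
      using mult_left_cancel_hyperfield[OF \<open>X f \<noteq> 0\<close>] involution_inject[OF \<tau>] by blast
  qed
  moreover have "Y \<in> extensional E" using Y by (simp add: perp_def PiE_def)
  ultimately have "Y = scale_vec E \<alpha> Y'"
    by (auto simp: scale_vec_def fun_eq_iff extensional_def)
  with \<alpha>(1) that show thesis by blast
qed

text \<open>Supports of non-zero orthogonal vectors contain matroid cocircuits, which form an
  antichain. So the minimal supports are exactly the cocircuits, and a vector on one of them is a
  multiple of an element of \<open>\<D>\<close>.\<close>

lemma F_cocircuits_eq: "F_cocircuits \<tau> E \<C> = \<D>"
proof
  show "\<D> \<subseteq> F_cocircuits \<tau> E \<C>"
  proof
    fix Y assume Y: "Y \<in> \<D>"
    have "\<not> supp E Z \<subset> supp E Y" if Z: "Z \<in> perp \<tau> E \<C> - {zero_vec E}" for Z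
    proof
      assume less: "supp E Z \<subset> supp E Y"
      obtain Y' where "Y' \<in> \<D>" "supp E Y' \<subseteq> supp E Z"
        using perp_contains_cocircuit[OF Z] .
      with less Y supp_cocircuits circuits_antichain[of "supp E Y'" E "dual_ind E Ind" "supp E Y"]
      show False by blast
    qed
    with Y cocircuit_signature_subset_perp show "Y \<in> F_cocircuits \<tau> E \<C>"
      unfolding F_cocircuits_def by blast
  qed
  show "F_cocircuits \<tau> E \<C> \<subseteq> \<D>"
  proof
    fix Y assume "Y \<in> F_cocircuits \<tau> E \<C>"
    then have Y: "Y \<in> perp \<tau> E \<C> - {zero_vec E}"
      and min: "\<And>Z. Z \<in> perp \<tau> E \<C> - {zero_vec E} \<Longrightarrow> \<not> supp E Z \<subset> supp E Y"
      unfolding F_cocircuits_def by blast+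
    obtain Y' where Y': "Y' \<in> \<D>" "supp E Y' \<subseteq> supp E Y" using perp_contains_cocircuit[OF Y] .
    then have "supp E Y' = supp E Y" using min[of Y'] cocircuit_signature_subset_perp by blast
    then obtain \<alpha> where "\<alpha> \<noteq> 0" "Y = scale_vec E \<alpha> Y'" using perp_eq_scale_vec Y Y'(1) by blast
    with Y'(1) cocircuit_signature show "Y \<in> \<D>" by (simp add: F_signature_def)
  qed
qed

section \<open>Modular elimination\<close>

lemma modular_elimination:
  fixes k :: nat and e :: "nat \<Rightarrow> 'e"
  defines "K \<equiv> {1..k}"
  assumes X: "X \<in> \<C>" and Xs: "\<And>i. i \<in> K \<Longrightarrow> Xs i \<in> \<C>"
    and modular: "modular_family E \<C> (k + 1) (insert X (Xs ` K))"
    and not_sub: "\<not> supp E X \<subseteq> (\<Union>i\<in>K. supp E (Xs i))"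
    and e: "\<And>i. i \<in> K \<Longrightarrow> e i \<in> supp E X \<inter> supp E (Xs i) - (\<Union>j\<in>K - {i}. supp E (Xs j))"
    and e_neg: "\<And>i. i \<in> K \<Longrightarrow> X (e i) = - Xs i (e i)"
  shows "\<exists>Z\<in>\<C>. (\<forall>i\<in>K. Z (e i) = 0) \<and>
           (\<forall>f\<in>E. Z f \<in> {X f} \<boxplus>\<^sub>s hypersum (\<lambda>i. Xs i f) K)"
proof -
  have "finite K" by (simp add: K_def)
  have e_X: "e i \<in> supp E X" and e_Xs: "e i \<in> supp E (Xs i)" if "i \<in> K" for i
    using e[OF that] by auto
  define U where "U = supp E X \<union> (\<Union>i\<in>K. supp E (Xs i))"
  have "U \<subseteq> E" by (auto simp: U_def supp_def)
  then have "finite U" using finite_ground finite_subset by blast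
  obtain e0 where e0: "e0 \<in> supp E X" "\<And>i. i \<in> K \<Longrightarrow> e0 \<notin> supp E (Xs i)"
    using not_sub by blast
  have "e0 \<in> E" "X e0 \<noteq> 0" using e0(1) by (auto simp: supp_def)
  have e0_notin: "e0 \<notin> e ` K" using e e0(2) by blast
  \<comment> \<open>Injectivity allows the sum over the elements \<open>e i\<close> to be reindexed
    by \<open>K\<close> at the end.\<close>
  have inj: "inj_on e K"
  proof (rule inj_onI, rule ccontr)
    fix i j assume ij: "i \<in> K" "j \<in> K" "e i = e j" "i \<noteq> j"
    then have "e i \<in> supp E (Xs j)" using e[of j] by simp
    with e[of i] ij show False by blast
  qed
  have Xs_at_e: "Xs j (e i) = 0" if "i \<in> K" "j \<in> K" "j \<noteq> i" for i j
    using e[OF that(1)] that by (auto simp: supp_def)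
  define I where "I = U - insert e0 (e ` K)"
  \<comment> \<open>Relative to \<open>I\<close>, each \<open>Xs i\<close> has \<open>e i\<close> as
    its only extra element, while \<open>X\<close> has \<open>e0\<close> and all
    \<open>e i\<close>.\<close>
  have supp_X: "supp E X \<subseteq> insert e0 (I \<union> e ` K)" by (auto simp: I_def U_def)
  have supp_Xs: "supp E (Xs i) \<subseteq> insert (e i) I" if i: "i \<in> K" for i
  proof
    fix g assume g: "g \<in> supp E (Xs i)"
    then have "g \<noteq> e j" if "j \<in> K" "j \<noteq> i" for j using e[OF \<open>j \<in> K\<close>] i that by blast
    with g i e0(2)[OF i] show "g \<in> insert (e i) I" by (auto simp: I_def U_def)
  qed

  have "I \<in> Ind"
  proof (rule ccontr)
    assume "I \<notin> Ind"
    then obtain C where C: "C \<in> circuits E Ind" "C \<subseteq> I"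
      using dependent_contains_circuit[OF finite_ground, of I] \<open>U \<subseteq> E\<close> unfolding I_def by blast
    have "C \<noteq> {}" using C(1) ind_empty by (auto simp: circuits_def)
    \<comment> \<open>The chain is the empty set, then \<open>C\<close> (at \<open>n = 1\<close> the
      union is empty), then the supports of the \<open>Xs i\<close> added one at a time, and finally
      \<open>U\<close> at index \<open>k + 2\<close>.\<close>
    define V where "V n = (if n = 0 then {} else if n = k + 2 then U
      else C \<union> (\<Union>i\<in>{1..<n}. supp E (Xs i)))" for n
    have V_top: "V (k + 2) = U" by (simp add: V_def)
    have "V n \<in> support_unions E \<C>" if "n \<le> k + 2" for n
    proof -
      consider "n = 0" | "n = k + 2" | "0 < n" "n < k + 2" using \<open>n \<le> k + 2\<close> by linarith
      then have "\<exists>S \<subseteq> supp E ` \<C>. V n = \<Union>S"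
      proof cases
        case 1
        then show ?thesis by (auto simp: V_def)
      next
        case 2
        then show ?thesis using X Xs
          by (intro exI[of _ "insert (supp E X) (supp E ` Xs ` K)"]) (auto simp: V_def U_def)
      next
        case 3
        then have "i \<in> K" if "i \<in> {1..<n}" for i using that by (auto simp: K_def)
        with 3 C(1) Xs supp_circuits show ?thesis
          by (intro exI[of _ "insert C (supp E ` Xs ` {1..<n})"]) (auto simp: V_def)
      qed
      then show ?thesis by (auto simp: support_unions_def)
    qed
    moreover have "V n \<subset> V (Suc n)" if "n < k + 2" for n
    proof -
      \<comment> \<open>Each step gains an element: one of \<open>C\<close>, then
        \<open>e n\<close>, which lies neither in \<open>C\<close> nor in another
        \<open>Xs i\<close>, and finally \<open>e0\<close>.\<close>
      consider "n = 0" | "0 < n" "n \<in> K" | "n = k + 1"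
        using \<open>n < k + 2\<close> by (force simp: K_def)
      then show ?thesis
      proof cases
        case 1
        then show ?thesis using \<open>C \<noteq> {}\<close> by (auto simp: V_def)
      next
        case 2
        then have "n \<le> k" by (simp add: K_def)
        have "e n \<notin> C" using C(2) 2 by (auto simp: I_def)
        moreover have "e n \<notin> supp E (Xs i)" if "i \<in> {1..<n}" for i
          using that e[OF 2(2)] \<open>n \<le> k\<close> by (auto simp: K_def)
        ultimately have "e n \<notin> V n" using 2(1) \<open>n \<le> k\<close> by (auto simp: V_def)
        moreover have "V (Suc n) = V n \<union> supp E (Xs n)"
          using 2(1) \<open>n \<le> k\<close> by (auto simp: V_def atLeastLessThanSuc)
        ultimately show ?thesis using e[OF 2(2)] by blast
      next
        case 3
        have "{1..<n} = K" using 3 by (auto simp: K_def)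
        then have "V n = C \<union> (\<Union>i\<in>K. supp E (Xs i))" using 3 by (simp add: V_def)
        moreover have "V (Suc n) = U" using 3 by (simp add: V_def)
        moreover have "e0 \<notin> C" using C(2) by (auto simp: I_def)
        ultimately show ?thesis using e0 C(2) by (auto simp: U_def I_def)
      qed
    qed
    ultimately have "k + 2 \<le> height (support_unions E \<C>) (V (k + 2))"
      using \<open>finite U\<close> V_top by (intro chain_length_le_height) simp_all
    \<comment> \<open>Modularity of the \<open>k + 1\<close> vectors puts the height one below the
      length of this chain.\<close>
    moreover have "height (support_unions E \<C>) U = k + 1"
      using modular by (simp add: modular_family_def U_def image_image)
    ultimately show False using V_top by simp
  qed

  \<comment> \<open>Otherwise a cocircuit would meet this set in \<open>e0\<close> only; it cannot contain any \<open>e i\<close>, because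
    of the circuit \<open>Xs i\<close>, and so it would meet the circuit \<open>X\<close> in \<open>e0\<close> only.\<close>
  have "insert e0 I \<notin> Ind"
  proof
    assume "insert e0 I \<in> Ind"
    then obtain D where "D \<in> circuits E (dual_ind E Ind)" "D \<inter> insert e0 I = {e0}"
      using ex_cocircuit_inter_independent by blast
    then obtain Y where Y: "Y \<in> \<D>" "supp E Y \<inter> insert e0 I = {e0}"
      using supp_cocircuits by (metis imageE)
    have "e0 \<notin> I" by (simp add: I_def)
    with Y(2) have Y_I: "e0 \<in> supp E Y" "supp E Y \<inter> I = {}" by auto
    have "e i \<notin> supp E Y" if i: "i \<in> K" for i
    proof
      assume "e i \<in> supp E Y"
      then have "supp E (Xs i) \<inter> supp E Y = {e i}"
        using Y_I(2) e_Xs[OF i] supp_Xs[OF i] by auto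
      with orthogonal_supp_inter_not_singleton[OF finite_ground \<tau> orth[OF Xs[OF i] Y(1)]]
      show False by blast
    qed
    then have "supp E X \<inter> supp E Y = {e0}" using Y_I e0(1) supp_X by auto
    with orthogonal_supp_inter_not_singleton[OF finite_ground \<tau> orth[OF X Y(1)]]
    show False by blast
  qed
  then obtain C where C: "C \<in> circuits E Ind" "C \<subseteq> insert e0 I"
    using dependent_contains_circuit[OF finite_ground, of "insert e0 I"] \<open>U \<subseteq> E\<close> \<open>e0 \<in> E\<close>
    unfolding I_def by blast
  \<comment> \<open>Independence of \<open>I\<close> forces \<open>e0\<close> into the circuit,
    which makes the scaling at \<open>e0\<close> possible.\<close>
  have "C \<notin> Ind" using C(1) by (simp add: circuits_def)
  then have "\<not> C \<subseteq> I" using \<open>I \<in> Ind\<close> ind_mono by blast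
  with C(2) have "e0 \<in> C" by blast
  obtain Z' where Z': "Z' \<in> \<C>" "supp E Z' = C"
    using C(1) supp_circuits by (metis imageE)
  then have "Z' e0 \<noteq> 0" using \<open>e0 \<in> C\<close> by (auto simp: supp_def)
  then obtain \<alpha> where \<alpha>: "\<alpha> \<noteq> 0" "\<alpha> * Z' e0 = X e0"
    using ex_scalar_hyperfield \<open>X e0 \<noteq> 0\<close> by metis
  define Z where "Z = scale_vec E \<alpha> Z'"
  have "Z \<in> \<C>" using Z' \<alpha>(1) circuit_signature by (simp add: Z_def F_signature_def)
  have Z_e0: "Z e0 = X e0" using \<alpha> \<open>e0 \<in> E\<close> by (simp add: Z_def scale_vec_def)
  have supp_Z: "supp E Z = C" using Z' \<alpha> by (simp add: Z_def supp_scale_vec)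
  have Z_off: "Z f = 0" if "f \<in> E" "f \<notin> insert e0 I" for f
    using that C(2) supp_Z by (auto simp: supp_def)
  have Z_e: "Z (e i) = 0" if i: "i \<in> K" for i
  proof (rule Z_off)
    show "e i \<in> E" using e_X[OF i] by (simp add: supp_def)
    show "e i \<notin> insert e0 I" using e0_notin i by (auto simp: I_def)
  qed

  have "Z f \<in> {X f} \<boxplus>\<^sub>s hypersum (\<lambda>i. Xs i f) K" if "f \<in> E" for f
  proof -
    \<comment> \<open>Outside \<open>I\<close> the sum collapses: all terms vanish off
      \<open>U\<close>, only \<open>X\<close> contributes at \<open>e0\<close>, and \<open>X\<close>
      and \<open>Xs i\<close> cancel at \<open>e i\<close>. Only \<open>f \<in> I\<close> needs a
      cocircuit.\<close>
    consider "f \<notin> U" | "f = e0" | i where "i \<in> K" "f = e i" | "f \<in> I"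
      unfolding I_def by blast
    then show ?thesis
    proof cases
      case 1
      then have "Z f = 0" using Z_off[OF \<open>f \<in> E\<close>] e0(1) by (auto simp: I_def U_def)
      moreover have "X f = 0" "\<And>i. i \<in> K \<Longrightarrow> Xs i f = 0"
        using 1 \<open>f \<in> E\<close> by (auto simp: U_def supp_def)
      ultimately show ?thesis by (simp add: hypersum_zero set_hadd_zero)
    next
      case 2
      have "Xs i f = 0" if "i \<in> K" for i using e0(2)[OF that] 2 \<open>f \<in> E\<close> by (simp add: supp_def)
      then show ?thesis using Z_e0 2 by (simp add: hypersum_zero set_hadd_zero)
    next
      case (3 i)
      have "hypersum (\<lambda>j. Xs j f) K = {Xs i f}"
        by (rule hypersum_single_nonzero) (use 3 \<open>finite K\<close> Xs_at_e in auto)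
      then show ?thesis
        using Z_e[OF 3(1)] e_neg[OF 3(1)] 3(2)
        by (simp add: zero_in_minus_set_hadd_iff)
    next
      case 4
      then obtain D where "D \<in> circuits E (dual_ind E Ind)" "D \<inter> I = {f}"
        using ex_cocircuit_inter_independent[OF \<open>I \<in> Ind\<close>] by blast
      then obtain Y where Y: "Y \<in> \<D>" "supp E Y \<inter> I = {f}"
        using supp_cocircuits by (metis imageE)
      define y where "y = \<tau> (Y f)"
      have "f \<in> supp E Y" using Y(2) by blast
      then have "y \<noteq> 0" by (simp add: y_def supp_def involution_eq_0_iff[OF \<tau>])
      have f_notin: "f \<noteq> e0" "f \<notin> e ` K" using 4 by (auto simp: I_def)
      have e_in_E: "e i \<in> E" if "i \<in> K" for i using e_X[OF that] by (simp add: supp_def)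
      \<comment> \<open>The minus sign from orthogonality and the one in
        \<open>X (e i) = - Xs i (e i)\<close> cancel.\<close>
      have at_f: "Xs i f * y = X (e i) * \<tau> (Y (e i))" if i: "i \<in> K" for i
      proof -
        have "Xs i (e i) * \<tau> (Y (e i)) = - (Xs i f * y)"
          unfolding y_def
          by (rule orthogonal_supp_inter_pair[OF finite_ground \<tau> orth[OF Xs[OF i] Y(1)]])
            (use Y(2) supp_Xs[OF i] f_notin i e_in_E \<open>f \<in> E\<close> in auto)
        then show ?thesis
          by (simp add: e_neg[OF i] mult_minus_left_hyperfield minus_minus_hyperfield)
      qed
      have at_e0: "X e0 * \<tau> (Y e0) = - (Z f * y)"
        unfolding y_def Z_e0[symmetric]
        by (rule orthogonal_supp_inter_pair[OF finite_ground \<tau> orth[OF \<open>Z \<in> \<C>\<close> Y(1)]])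
          (use Y(2) supp_Z C(2) f_notin \<open>e0 \<in> E\<close> \<open>f \<in> E\<close> in auto)
      \<comment> \<open>The terms of \<open>X \<perp> Y\<close> at \<open>e0\<close> and at the
        \<open>e i\<close> are replaced by \<open>- (Z f * y)\<close> and \<open>Xs i f * y\<close>.
        What remains is the desired membership multiplied by the non-zero \<open>y\<close>.\<close>
      have "0 \<in> hypersum (\<lambda>g. X g * \<tau> (Y g)) (insert e0 (insert f (e ` K)))"
        by (rule orthogonal_supp_inter[OF finite_ground \<tau> orth[OF X Y(1)]])
          (use Y(2) supp_X \<open>e0 \<in> E\<close> \<open>f \<in> E\<close> e_in_E in auto)
      also have "hypersum (\<lambda>g. X g * \<tau> (Y g)) (insert e0 (insert f (e ` K)))
          = {X e0 * \<tau> (Y e0)} \<boxplus>\<^sub>s ({X f * y} \<boxplus>\<^sub>s hypersum (\<lambda>i. X (e i) * \<tau> (Y (e i))) K)"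
        using f_notin e0_notin \<open>finite K\<close>
        by (simp add: hypersum_insert_set_hadd hypersum_reindex[OF inj] y_def)
      also have "hypersum (\<lambda>i. X (e i) * \<tau> (Y (e i))) K = hypersum (\<lambda>i. y * Xs i f) K"
        by (rule hypersum_cong) (simp add: at_f[symmetric] mult.commute)
      also have "{X f * y} \<boxplus>\<^sub>s hypersum (\<lambda>i. y * Xs i f) K
          = (*) y ` ({X f} \<boxplus>\<^sub>s hypersum (\<lambda>i. Xs i f) K)"
        by (simp add: hypersum_scale[OF \<open>finite K\<close>] set_hadd_scale mult.commute[of "X f"])
      finally have "y * Z f \<in> (*) y ` ({X f} \<boxplus>\<^sub>s hypersum (\<lambda>i. Xs i f) K)"
        by (simp only: at_e0 zero_in_minus_set_hadd_iff mult.commute[of "Z f"])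
      then show ?thesis by (auto dest: mult_left_cancel_hyperfield[OF \<open>y \<noteq> 0\<close>])
    qed
  qed
  with \<open>Z \<in> \<C>\<close> Z_e show ?thesis by blast
qed

text \<open>Nested supports are nested circuits, hence equal, so the signature supplies the scalar;
  the last axiom is modular elimination.\<close>

lemma strong_F_matroid: "strong_F_matroid E \<C>"
  unfolding strong_F_matroid_def
proof (intro conjI ballI allI impI)
  fix X Y assume "X \<in> \<C>" "Y \<in> \<C>" "supp E X \<subseteq> supp E Y"
  moreover from this supp_circuits have "supp E X = supp E Y"
    by (intro circuits_antichain[of _ E Ind]) auto
  ultimately show "\<exists>\<alpha>. \<alpha> \<noteq> 0 \<and> X = scale_vec E \<alpha> Y"
    using circuit_signature unfolding F_signature_def by blast
next
  show "\<C> \<subseteq> E \<rightarrow>\<^sub>E UNIV" "zero_vec E \<notin> \<C>"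
    "\<And>X \<alpha>. X \<in> \<C> \<Longrightarrow> \<alpha> \<noteq> 0 \<Longrightarrow> scale_vec E \<alpha> X \<in> \<C>"
    using circuit_signature by (auto simp: F_signature_def)
next
  fix k :: nat and X Xs e
  assume X: "X \<in> \<C>" and Xs: "\<forall>i\<in>{1..k}. Xs i \<in> \<C>"
    and modular: "modular_family E \<C> (k + 1) (insert X (Xs ` {1..k}))"
    and not_sub: "\<not> supp E X \<subseteq> (\<Union>i\<in>{1..k}. supp E (Xs i))"
    and e: "\<forall>i\<in>{1..k}.
      e i \<in> (supp E X \<inter> supp E (Xs i)) - (\<Union>j\<in>{1..k} - {i}. supp E (Xs j)) \<and>
      X (e i) = - Xs i (e i) \<and> X (e i) \<noteq> 0"
  show "\<exists>Z\<in>\<C>. (\<forall>i\<in>{1..k}. Z (e i) = 0) \<and>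
    (\<forall>f\<in>E. Z f \<in> {X f} \<boxplus>\<^sub>s hypersum (\<lambda>i. Xs i f) {1..k})"
    by (rule modular_elimination[OF X bspec[OF Xs] modular not_sub]) (use e in blast)+
qed

end

theorem theorem3p22:
  fixes \<tau> :: "'f::hyperfield \<Rightarrow> 'f"
    and E :: "'e set" and Ind :: "'e set set"
    and \<C> \<D> :: "('e \<Rightarrow> 'f) set"
  assumes "hyperfield_involution \<tau>"
    and "matroid E Ind" and "E \<noteq> {}"
    and "F_signature E Ind \<C>"
    and "F_signature E (dual_ind E Ind) \<D>"
  shows "(strong_F_matroid E \<C> \<and> has_underlying_matroid E \<C> Ind \<and> \<D> = F_cocircuits \<tau> E \<C>)
         \<longleftrightarrow> (\<forall>X\<in>\<C>. \<forall>Y\<in>\<D>. orthogonal \<tau> E X Y)"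
proof
  assume "strong_F_matroid E \<C> \<and> has_underlying_matroid E \<C> Ind \<and> \<D> = F_cocircuits \<tau> E \<C>"
  then show "\<forall>X\<in>\<C>. \<forall>Y\<in>\<D>. orthogonal \<tau> E X Y"
    by (auto simp: F_cocircuits_def perp_def)
next
  assume "\<forall>X\<in>\<C>. \<forall>Y\<in>\<D>. orthogonal \<tau> E X Y"
  then interpret orthogonal_signatures E Ind \<tau> \<C> \<D>
    using assms by (simp add: orthogonal_signatures_def orthogonal_signatures_axioms_def)
  show "strong_F_matroid E \<C> \<and> has_underlying_matroid E \<C> Ind \<and> \<D> = F_cocircuits \<tau> E \<C>"
    using strong_F_matroid F_cocircuits_eq supp_circuits assms(2)
    by (simp add: has_underlying_matroid_def)
qed

end
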